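(* Let $\mathbf{H}$ be a finite, atomic, connected hypergraph with carrier $H=\{x_1,\dots,x_n\}$. Then the map $T\mapsto \Pi(\psi(T))$ is an order-isomorphism from the set of constructs of $\mathbf{H}$, ordered by $\le^{\mathbf{H}}$, onto the set of non-empty faces of the polytope $\mathcal{G}(\mathbf{H})$, ordered by inclusion. That is, it is a bijection onto the non-empty faces, and for all constructs $S,T$ one has $S\le^{\mathbf H} T$ if and only if $\Pi(\psi(S))\subseteq\Pi(\psi(T))$.
   Context: A hypergraph $\mathbf{H}$ on a finite set $H$ (its carrier) is a set $\mathbf{H}\subseteq\mathcal{P}(H)\setminus\{\emptyset\}$ with $\bigcup\mathbf{H}=H$; it is atomic if $\{x\}\in\mathbf{H}$ for all $x\in H$. For $X\subseteq H$ put $\mathbf{H}_X=\{Z\in\mathbf{H}: Z\subseteq X\}$, a hypergraph on $X$. $\mathbf{H}$ is connected if there is no partition $H=X_1\cup X_2$ into two non-empty disjoint sets with $\mathbf{H}=\mathbf{H}_{X_1}\cup\mathbf{H}_{X_2}$; a non-empty $X\subseteq H$ is called connected if $\mathbf{H}_X$ is connected. Every finite hypergraph has a unique partition $H=X_1\cup\dots\cup X_m$ into connected components ($\mathbf H_{X_i}$ connected and $\mathbf{H}=\bigcup_i\mathbf{H}_{X_i}$). The notation $\mathbf{H},X\leadsto H_1,\dots,H_n$ means that $H_1,\dots,H_n$ are the connected components of $\mathbf{H}_{H\setminus X}$ (so $n=0$ iff $X=H$), and $\mathbf{H}_i:=\mathbf{H}_{H_i}$. ${\it Sat}(\mathbf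 H)$ is the set of all non-empty connected subsets of $H$. Constructs of a connected hypergraph $\mathbf{H}$ are rooted trees with nodes labelled by non-empty subsets of $H$, defined inductively: for a non-empty $Y\subseteq H$, if $Y=H$ the one-node tree labelled $H$ is a construct; if $Y\neq H$, $\mathbf{H},Y\leadsto H_1,\dots,H_n$ and $T_i$ is a construct of $\mathbf{H}_i$ for each $i$, then the tree $Y(T_1,\dots,T_n)$ whose root is labelled $Y$ and whose subtrees at the children of the root are $T_1,\dots,T_n$ (unordered) is a construct. A construction is a construct all of whose labels are singletons. The order $\le^{\mathbf H}$ on constructs is the smallest reflexive and transitive relation closed under: (i) if $\emptyset\ne Y\subsetneq H$, $\mathbf{H},Y\leadsto K_1,\dots,K_n$, $\emptyset\neq X\subseteq K_1$, $\mathbf{K}_1,X\leadsto H_{11},\dots,H_{1m}$, $T_{1j}$ constructs of $\mathbf H_{1j}$ and $T_i$ constructs of $\mathbf K_i$ ($2\le i\le n$), then $Y(X(T_{11},\dots,T_{1m}),T_2,\dots,T_n)\le^{\mathbf H}(Y\cup X)(T_{11},\dots,T_{1m},T_2,\dots,T_n)$; (ii) if $\mathbf H,Y\leadsto H_1,\dots,H_n$, $T_i$ are constructs of $\mathbf H_i$ ($i\ge 2$) and $T_1\le^{\mathbf H_1}T'_1$, then $Y(T_1,T_2,\dots,T_n)\le^{\mathbf H} Y(T_1',T_2,\dots,T_n)$. For a node labelled $Y$ of a construct $T$, $\uparrow_T(Y)$ is the union of the labels of $Y$ and of all its descendants; $\psi(T)=\{\uparrow_T(Y): Y\text{ a node of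 }T\}$. Geometric realisation: identify $x_i$ with index $i$. For non-empty $A\subseteq\{1,\dots,n\}$, $\pi_A^+=\{(x_1,\dots,x_n)\in\mathbb R^n:\sum_{i\in A}x_i\ge 3^{|A|}\}$ and $\pi_A=\{(x_1,\dots,x_n)\in\mathbb R^n:\sum_{i\in A}x_i= 3^{|A|}\}$. Then $\mathcal{G}(\mathbf H)=\bigcap\{\pi_Y^+: Y\in{\it Sat}(\mathbf H)\setminus\{H\}\}\cap\pi_H$, and for $M\subseteq{\it Sat}(\mathbf H)$, $\Pi(M)=\bigcap\{\pi_Y:Y\in M\}\cap\mathcal G(\mathbf H)$. *)

theory Defs
  imports "HOL-Analysis.Analysis" "HOL-Library.FSet" "HOL-Library.Disjoint_Sets"
begin

section \<open>Hypergraphs\<close>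

text \<open>
  A hypergraph is given by its set of hyperedges; as the hyperedges cover the carrier,
  the carrier is recovered as the union of the hyperedges.
\<close>

definition hypergraph_on :: "'a set \<Rightarrow> 'a set set \<Rightarrow> bool" where
  "hypergraph_on A H \<longleftrightarrow> finite A \<and> {} \<notin> H \<and> \<Union>H = A"

definition atomic :: "'a set set \<Rightarrow> bool" where
  "atomic H \<longleftrightarrow> (\<forall>x\<in>\<Union>H. {x} \<in> H)"

definition restr :: "'a set set \<Rightarrow> 'a set \<Rightarrow> 'a set set" where
  "restr H X = {Z \<in> H. Z \<subseteq> X}"

text \<open>
  For atomic \<open>H\<close> and \<open>X \<subseteq> \<Union>H\<close> the carrier of \<open>restr H X\<close> is \<open>X\<close>.
\<close>

lemma Union_restr:
  assumes "atomic H" "X \<subseteq> \<Union>H"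
  shows "\<Union>(restr H X) = X"
  using assms unfolding atomic_def restr_def by blast

definition hyp_connected :: "'a set set \<Rightarrow> bool" where
  "hyp_connected H \<longleftrightarrow>
     \<not> (\<exists>X1 X2. X1 \<noteq> {} \<and> X2 \<noteq> {} \<and> X1 \<inter> X2 = {} \<and> X1 \<union> X2 = \<Union>H \<and>
           H = restr H X1 \<union> restr H X2)"

definition connected_components_of_hyp :: "'a set set \<Rightarrow> 'a set set \<Rightarrow> bool" where
  "connected_components_of_hyp H P \<longleftrightarrow>
     partition_on (\<Union>H) P \<and> (\<forall>K\<in>P. hyp_connected (restr H K)) \<and> H = (\<Union>K\<in>P. restr H K)"

text \<open>
  \<open>leads_to H X P\<close>: the members of \<open>P\<close> are the connected components of \<open>H\<close> restricted to the
  complement of \<open>X\<close>.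
\<close>

definition leads_to :: "'a set set \<Rightarrow> 'a set \<Rightarrow> 'a set set \<Rightarrow> bool" where
  "leads_to H X P \<longleftrightarrow> connected_components_of_hyp (restr H (\<Union>H - X)) P"

definition Sat :: "'a set set \<Rightarrow> 'a set set" where
  "Sat H = {X. X \<noteq> {} \<and> X \<subseteq> \<Union>H \<and> hyp_connected (restr H X)}"


section \<open>Constructs\<close>

text \<open>
  The children of a node form a finite set, so that trees are unordered. Nothing is lost by not
  counting repetitions: sibling subtrees of a construct carry labels from disjoint components
  and hence are distinct.
\<close>

datatype 'a ctree = Node (root_label: "'a set") (children: "'a ctree fset")

inductive is_construct :: "'a set set \<Rightarrow> 'a ctree \<Rightarrow> bool" where
  single: "hyp_connected H \<Longrightarrow> \<Union>H \<noteq> {} \<Longrightarrow> is_construct H (Node (\<Union>H) {||})"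
| branch: "hyp_connected H \<Longrightarrow> Y \<noteq> {} \<Longrightarrow> Y \<subset> \<Union>H \<Longrightarrow> leads_to H Y P \<Longrightarrow>
    (\<forall>K\<in>P. is_construct (restr H K) (T K)) \<Longrightarrow> fset Ts = T ` P \<Longrightarrow>
    is_construct H (Node Y Ts)"

text \<open>
  In the rule \<open>contract\<close>, the trees \<open>T K\<close> are placed on the components other than \<open>K1\<close>, and the
  trees \<open>U L\<close> on the components of \<open>K1\<close> minus \<open>X\<close>.
\<close>

inductive construct_le :: "'a set set \<Rightarrow> 'a ctree \<Rightarrow> 'a ctree \<Rightarrow> bool" where
  refl: "is_construct H S \<Longrightarrow> construct_le H S S"
| trans: "construct_le H S S' \<Longrightarrow> construct_le H S' S'' \<Longrightarrow> construct_le H S S''"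
| contract: "hyp_connected H \<Longrightarrow> Y \<noteq> {} \<Longrightarrow> Y \<subset> \<Union>H \<Longrightarrow> leads_to H Y P \<Longrightarrow> K1 \<in> P \<Longrightarrow>
    X \<noteq> {} \<Longrightarrow> X \<subseteq> K1 \<Longrightarrow> leads_to (restr H K1) X Q \<Longrightarrow>
    (\<forall>L\<in>Q. is_construct (restr H L) (U L)) \<Longrightarrow> fset Us = U ` Q \<Longrightarrow>
    (\<forall>K\<in>P - {K1}. is_construct (restr H K) (T K)) \<Longrightarrow> fset Ts = T ` (P - {K1}) \<Longrightarrow>
    construct_le H (Node Y (finsert (Node X Us) Ts)) (Node (Y \<union> X) (Us |\<union>| Ts))"
| inside: "hyp_connected H \<Longrightarrow> Y \<noteq> {} \<Longrightarrow> Y \<subset> \<Union>H \<Longrightarrow> leads_to H Y P \<Longrightarrow> K1 \<in> P \<Longrightarrow>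
    (\<forall>K\<in>P - {K1}. is_construct (restr H K) (T K)) \<Longrightarrow> fset Ts = T ` (P - {K1}) \<Longrightarrow>
    construct_le (restr H K1) S S' \<Longrightarrow>
    construct_le H (Node Y (finsert S Ts)) (Node Y (finsert S' Ts))"

text \<open>
  A node of a construct is represented by the subtree rooted at it; distinct nodes of a construct
  have disjoint non-empty labels, hence distinct subtrees.
\<close>

primrec subtrees :: "'a ctree \<Rightarrow> 'a ctree set" where
  "subtrees (Node Y Ts) = insert (Node Y Ts) (\<Union>(fset (subtrees |`| Ts)))"

definition up :: "'a ctree \<Rightarrow> 'a set" where
  "up T = \<Union>(root_label ` subtrees T)"

definition psi :: "'a ctree \<Rightarrow> 'a set set" where
  "psi T = up ` subtrees T"


section \<open>Geometric realisation\<close>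

definition halfspace :: "'n set \<Rightarrow> (real ^ 'n::finite) set" where
  "halfspace A = {x. (\<Sum>i\<in>A. x $ i) \<ge> 3 ^ card A}"

definition hyperplane :: "'n set \<Rightarrow> (real ^ 'n::finite) set" where
  "hyperplane A = {x. (\<Sum>i\<in>A. x $ i) = 3 ^ card A}"

definition realisation :: "'n set set \<Rightarrow> (real ^ 'n::finite) set" where
  "realisation H = \<Inter>(halfspace ` (Sat H - {\<Union>H})) \<inter> hyperplane (\<Union>H)"

text \<open>
  The realisation is a polytope, so that its faces may be taken in the sense of \<open>face_of\<close>.
\<close>

lemma polytope_realisation:
  fixes H :: "'n::finite set set"
  assumes H: "hypergraph_on UNIV H" and at: "atomic H"
  shows "polytope (realisation H)"
proof -
  have sum_inner: "(\<Sum>i\<in>A. x $ i) = (\<chi> i. if i \<in> A then 1 else 0) \<bullet> x" for A and x :: "real ^ 'n"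
  proof -
    have "(\<chi> i. if i \<in> A then 1 else 0) \<bullet> x = (\<Sum>i\<in>UNIV. if i \<in> A then x $ i else 0)"
      unfolding inner_vec_def by (intro sum.cong) auto
    also have "\<dots> = (\<Sum>i\<in>A. x $ i)" by (simp add: sum.If_cases)
    finally show ?thesis by simp
  qed
  have "polyhedron (halfspace A)" for A :: "'n set"
    unfolding halfspace_def sum_inner by (rule polyhedron_halfspace_ge)
  moreover have "polyhedron (hyperplane A)" for A :: "'n set"
    unfolding hyperplane_def sum_inner by (rule polyhedron_hyperplane)
  ultimately have ph: "polyhedron (realisation H)"
    unfolding realisation_def by (intro polyhedron_Int polyhedron_Inter) auto
  have U: "\<Union>H = UNIV" using H by (simp add: hypergraph_on_def)
  have ge: "0 \<le> x $ i" if x: "x \<in> realisation H" for x :: "real ^ 'n" and i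
  proof (cases "{i} = (UNIV :: 'n set)")
    case True
    have "(\<Sum>j\<in>UNIV. x $ j) = 3 ^ CARD('n)"
      using x unfolding realisation_def hyperplane_def U by simp
    then have "x $ i = 3 ^ CARD('n)" by (simp flip: True)
    then show ?thesis by simp
  next
    case False
    have "hyp_connected (restr H {i})"
      unfolding hyp_connected_def
    proof
      assume "\<exists>X1 X2. X1 \<noteq> {} \<and> X2 \<noteq> {} \<and> X1 \<inter> X2 = {} \<and> X1 \<union> X2 = \<Union>(restr H {i}) \<and>
        restr H {i} = restr (restr H {i}) X1 \<union> restr (restr H {i}) X2"
      then obtain X1 X2 where X: "X1 \<noteq> {}" "X2 \<noteq> {}" "X1 \<inter> X2 = {}" "X1 \<union> X2 = \<Union>(restr H {i})"
        by blast
      have "\<Union>(restr H {i}) \<subseteq> {i}" by (auto simp: restr_def)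
      with X(4) have "X1 \<subseteq> {i}" "X2 \<subseteq> {i}" by auto
      with X(1-3) show False by (auto simp: subset_singleton_iff)
    qed
    then have "{i} \<in> Sat H - {\<Union>H}"
      using False U by (auto simp: Sat_def)
    then have "x \<in> halfspace {i}" using x by (auto simp: realisation_def)
    then show ?thesis by (simp add: halfspace_def)
  qed
  have "bounded (realisation H)"
    unfolding bounded_iff
  proof (intro exI ballI)
    fix x assume x: "x \<in> realisation H"
    have "norm x \<le> (\<Sum>i\<in>UNIV. \<bar>x $ i\<bar>)" by (rule norm_le_l1_cart)
    also have "\<dots> = (\<Sum>i\<in>UNIV. x $ i)" using ge[OF x] by simp
    also have "\<dots> = 3 ^ CARD('n)" using x unfolding realisation_def hyperplane_def U by simp
    finally show "norm x \<le> 3 ^ CARD('n)" .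
  qed
  with ph show ?thesis by (simp add: polytope_eq_bounded_polyhedron)
qed

definition Pi_face :: "'n set set \<Rightarrow> 'n set set \<Rightarrow> (real ^ 'n::finite) set" where
  "Pi_face H M = \<Inter>(hyperplane ` M) \<inter> realisation H"

end

theory Submission
  imports Defs
begin

text \<open>
  Call a set \<open>N\<close> of connected sets containing the carrier nested if a union of members of \<open>N\<close> is
  connected only when it is itself one of these members. Constructs correspond via \<open>psi\<close> to nested
  sets: the root label is what the proper members leave uncovered, and the components of its
  complement are again members. Moreover \<open>S \<le> T\<close> iff \<open>psi T \<subseteq> psi S\<close>, as any single member of
  \<open>psi S\<close> other than the carrier can be removed by contracting an edge of \<open>S\<close>.

  On the geometric side, the inequalities tight at a point of the realisation form a nested set, since
  \<open>3\<^sup>a + 3\<^sup>b < 3\<^sup>c\<close> for \<open>a, b < c\<close>. Conversely, for each construct \<open>T\<close> there is a point at which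
  precisely the inequalities in \<open>psi T\<close> are tight: spread the mass not used by the children evenly
  over the root label, recursively. A non-empty face is determined by the inequalities tight at a
  point of its relative interior.
\<close>

section \<open>Restrictions and connected components\<close>

text \<open>Taking the carrier to be \<open>\<Union>H\<close> makes the predicate pass to every
  restriction with no side condition, which the inductions over components rely on.\<close>

abbreviation atomic_hyp :: "'a set set \<Rightarrow> bool" where
  "atomic_hyp H \<equiv> hypergraph_on (\<Union>H) H \<and> atomic H"

lemma restr_restr: "L \<subseteq> K \<Longrightarrow> restr (restr H K) L = restr H L"
  by (auto simp: restr_def)

lemma restr_Union: "restr H (\<Union>H) = H"
  by (auto simp: restr_def)

lemma atomic_hyp_restr: "atomic_hyp H \<Longrightarrow> atomic_hyp (restr H K)"
  unfolding hypergraph_on_def atomic_def restr_def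
  by (auto intro: finite_subset[of _ "\<Union>H"])

lemma Sat_restr:
  assumes "atomic H" "K \<subseteq> \<Union>H"
  shows "Sat (restr H K) = {A \<in> Sat H. A \<subseteq> K}"
  unfolding Sat_def Union_restr[OF assms] using assms by (auto simp: restr_restr)

lemma Union_in_Sat: "hyp_connected H \<Longrightarrow> \<Union>H \<noteq> {} \<Longrightarrow> \<Union>H \<in> Sat H"
  by (simp add: Sat_def restr_Union)

text \<open>Blocks of the partition avoid \<open>Y\<close>, so the preliminary restriction to the
  complement of \<open>Y\<close> changes nothing on them; only single restrictions of
  \<open>H\<close> remain.\<close>

lemma leads_to_iff:
  assumes "atomic H"
  shows "leads_to H Y P \<longleftrightarrow>
    partition_on (\<Union>H - Y) P \<and> (\<forall>K\<in>P. hyp_connected (restr H K)) \<and>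
    restr H (\<Union>H - Y) = (\<Union>K\<in>P. restr H K)"
proof -
  have U: "\<Union>(restr H (\<Union>H - Y)) = \<Union>H - Y"
    using assms by (intro Union_restr) auto
  have r: "restr (restr H (\<Union>H - Y)) K = restr H K" if "partition_on (\<Union>H - Y) P" "K \<in> P" for K
    using that by (intro restr_restr) (auto simp: partition_on_def)
  have "(\<forall>K\<in>P. hyp_connected (restr (restr H (\<Union>H - Y)) K)) \<longleftrightarrow> (\<forall>K\<in>P. hyp_connected (restr H K))"
    "(\<Union>K\<in>P. restr (restr H (\<Union>H - Y)) K) = (\<Union>K\<in>P. restr H K)"
    if "partition_on (\<Union>H - Y) P"
    using r[OF that] by (metis, metis (no_types, lifting) SUP_cong)
  then show ?thesis
    unfolding leads_to_def connected_components_of_hyp_def U by (metis (no_types, lifting))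
qed

lemma leads_to_partition: "atomic H \<Longrightarrow> leads_to H Y P \<Longrightarrow> partition_on (\<Union>H - Y) P"
  by (simp add: leads_to_iff)

lemma leads_to_subset: "atomic H \<Longrightarrow> leads_to H Y P \<Longrightarrow> K \<in> P \<Longrightarrow> K \<subseteq> \<Union>H - Y"
  using partition_onD1[OF leads_to_partition[of H Y P]] by blast

lemma leads_to_Sat: "atomic H \<Longrightarrow> leads_to H Y P \<Longrightarrow> P \<subseteq> Sat H"
  by (auto simp: leads_to_iff partition_on_def Sat_def)

lemma leads_to_finite: "atomic_hyp H \<Longrightarrow> leads_to H Y P \<Longrightarrow> finite P"
  using leads_to_partition[of H Y P] finite_elements[of "\<Union>H - Y" P] by (simp add: hypergraph_on_def)

lemma partition_on_block_unique:
  "partition_on A P \<Longrightarrow> K \<in> P \<Longrightarrow> L \<in> P \<Longrightarrow> K \<inter> L \<noteq> {} \<Longrightarrow> K = L"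
  unfolding partition_on_def disjoint_def by blast

lemma partition_on_disjoint_Un:
  assumes "partition_on A P" "partition_on B Q" "A \<inter> B = {}"
  shows "partition_on (A \<union> B) (P \<union> Q)"
  using assms unfolding partition_on_def by (simp add: disjoint_union)

text \<open>Induction on the size of the carrier: a separation yields two smaller pieces, and their
  components together are those of \<open>H\<close>.\<close>

lemma components_exist:
  assumes "atomic_hyp H"
  shows "\<exists>P. connected_components_of_hyp H P"
  using assms
proof (induction "card (\<Union>H)" arbitrary: H rule: less_induct)
  case less
  have fin: "finite (\<Union>H)" and ne: "{} \<notin> H" and at: "atomic H"
    using less.prems by (auto simp: hypergraph_on_def)
  show ?case
  proof (cases "hyp_connected H")
    case True
    show ?thesis
    \<comment> \<open>The empty hypergraph counts as connected, but its partition must be empty,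
      since a block may not be.\<close>
    proof (cases "\<Union>H = {}")
      case True
      with ne have "H = {}" by auto
      then have "connected_components_of_hyp H {}"
        by (simp add: connected_components_of_hyp_def partition_on_def)
      then show ?thesis ..
    next
      case False
      with True have "connected_components_of_hyp H {\<Union>H}"
        by (simp add: connected_components_of_hyp_def restr_Union partition_on_space)
      then show ?thesis ..
    qed
  next
    case False
    then obtain X1 X2 where X: "X1 \<noteq> {}" "X2 \<noteq> {}" "X1 \<inter> X2 = {}" "X1 \<union> X2 = \<Union>H"
      "H = restr H X1 \<union> restr H X2"
      unfolding hyp_connected_def by blast
    have U: "\<Union>(restr H X1) = X1" "\<Union>(restr H X2) = X2"
      using X(4) at by (auto intro!: Union_restr)
    have "X1 \<subset> \<Union>H" "X2 \<subset> \<Union>H" using X(1-4) by auto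
    then have "card X1 < card (\<Union>H)" "card X2 < card (\<Union>H)"
      using fin by (auto intro: psubset_card_mono)
    then obtain P1 P2 where P: "connected_components_of_hyp (restr H X1) P1"
      "connected_components_of_hyp (restr H X2) P2"
      using less.hyps[of "restr H X1"] less.hyps[of "restr H X2"] U
        atomic_hyp_restr[OF less.prems] by metis
    have sub: "K \<in> P1 \<Longrightarrow> K \<subseteq> X1" "K \<in> P2 \<Longrightarrow> K \<subseteq> X2" for K
      using P U by (auto simp: connected_components_of_hyp_def partition_on_def)
    have r: "restr (restr H X1) K = restr H K" if "K \<in> P1" for K
      using sub(1)[OF that] by (rule restr_restr)
    have r': "restr (restr H X2) K = restr H K" if "K \<in> P2" for K
      using sub(2)[OF that] by (rule restr_restr)
    have "partition_on (\<Union>H) (P1 \<union> P2)"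
      using partition_on_disjoint_Un[of X1 P1 X2 P2] P U X(3,4)
      by (simp add: connected_components_of_hyp_def)
    moreover have "\<forall>K\<in>P1 \<union> P2. hyp_connected (restr H K)"
      using P r r' by (auto simp: connected_components_of_hyp_def)
    moreover have "H = (\<Union>K\<in>P1 \<union> P2. restr H K)"
      using P r r' X(5) unfolding connected_components_of_hyp_def by (metis (no_types, lifting) SUP_cong UN_Un)
    ultimately have "connected_components_of_hyp H (P1 \<union> P2)"
      by (simp add: connected_components_of_hyp_def)
    then show ?thesis ..
  qed
qed

lemma leads_to_exists:
  assumes "atomic_hyp H"
  obtains P where "leads_to H Y P"
  using components_exist[OF atomic_hyp_restr[OF assms]] unfolding leads_to_def by blast

text \<open>Each hyperedge inside \<open>A\<close> lies in a single component. If \<open>A\<close>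
  met \<open>K\<close> without lying in it, \<open>A \<inter> K\<close> and \<open>A - K\<close>
  would separate \<open>A\<close>.\<close>

lemma Sat_in_component:
  assumes at: "atomic H" and P: "leads_to H Y P" and A: "A \<in> Sat H" "A \<inter> Y = {}"
  obtains K where "K \<in> P" "A \<subseteq> K"
proof -
  have AH: "A \<subseteq> \<Union>H" "A \<noteq> {}" and con: "hyp_connected (restr H A)"
    using A by (auto simp: Sat_def)
  have pt: "partition_on (\<Union>H - Y) P" and ed: "restr H (\<Union>H - Y) = (\<Union>K\<in>P. restr H K)"
    using P at by (auto simp: leads_to_iff)
  have "A \<subseteq> \<Union>P" using AH(1) A(2) partition_onD1[OF pt] by blast
  then obtain K where K: "K \<in> P" "A \<inter> K \<noteq> {}" using AH(2) by blast
  have "A \<subseteq> K"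
  proof (rule ccontr)
    assume n: "\<not> A \<subseteq> K"
    have "Z \<subseteq> A \<inter> K \<or> Z \<subseteq> A - K" if "Z \<in> restr H A" for Z
    proof -
      have "Z \<in> restr H (\<Union>H - Y)" using that AH A(2) by (auto simp: restr_def)
      then obtain K' where K': "K' \<in> P" "Z \<subseteq> K'" unfolding ed by (auto simp: restr_def)
      have "K' = K \<or> K' \<inter> K = {}" using partition_on_block_unique[OF pt K'(1) K(1)] by blast
      then show ?thesis using K' that by (auto simp: restr_def)
    qed
    then have "restr H A = restr (restr H A) (A \<inter> K) \<union> restr (restr H A) (A - K)"
      by (auto simp: restr_def)
    moreover have "(A \<inter> K) \<union> (A - K) = \<Union>(restr H A)" using Union_restr[OF at AH(1)] by auto
    ultimately show False
      using con n K(2) unfolding hyp_connected_def by (metis Diff_eq_empty_iff Diff_disjoint inf_assoc inf_bot_right)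
  qed
  with K that show thesis by blast
qed

text \<open>A block of one partition is connected, so it lies in a block of the other, which in turn
  lies in a block of the first; disjointness makes all three equal.\<close>

lemma leads_to_unique:
  assumes at: "atomic H" and P: "leads_to H Y P" and Q: "leads_to H Y Q"
  shows "P = Q"
proof -
  have "P \<subseteq> Q" if P: "leads_to H Y P" and Q: "leads_to H Y Q" for P Q
  proof
    fix K assume K: "K \<in> P"
    note pt = leads_to_partition[OF at P] leads_to_partition[OF at Q]
    have "K \<in> Sat H" "K \<inter> Y = {}" using K leads_to_Sat[OF at P] pt by (auto simp: partition_on_def)
    then obtain L where L: "L \<in> Q" "K \<subseteq> L" using Sat_in_component[OF at Q] by blast
    have "L \<in> Sat H" "L \<inter> Y = {}" using L leads_to_Sat[OF at Q] pt by (auto simp: partition_on_def)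
    then obtain K' where K': "K' \<in> P" "L \<subseteq> K'" using Sat_in_component[OF at P] by blast
    have "K \<noteq> {}" using K pt by (auto simp: partition_on_def)
    moreover have "K \<subseteq> K'" using L K' by blast
    ultimately have "K = K'" using partition_on_block_unique[OF pt(1) K K'(1)] by blast
    then have "K = L" using L K' by auto
    with L show "K \<in> Q" by simp
  qed
  then show ?thesis using P Q by blast
qed

section \<open>Constructs and their nested sets\<close>

lemma up_Node: "up (Node Y Ts) = Y \<union> (\<Union>T\<in>fset Ts. up T)"
  by (auto simp: up_def)

lemma psi_Node: "psi (Node Y Ts) = insert (up (Node Y Ts)) (\<Union>T\<in>fset Ts. psi T)"
  by (auto simp: psi_def)

lemma up_in_psi: "up T \<in> psi T"
  by (cases T) (simp add: psi_Node)

text \<open>A leaf is a node whose label leaves no components, so the two introduction rules merge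
  into one.\<close>

lemma is_construct_Node:
  assumes "atomic_hyp H" "hyp_connected H" "Y \<noteq> {}" "Y \<subseteq> \<Union>H" "leads_to H Y P"
    and "\<forall>K\<in>P. is_construct (restr H K) (f K)" "fset Ts = f ` P"
  shows "is_construct H (Node Y Ts)"
proof (cases "Y = \<Union>H")
  case True
  then have "P = {}" using assms leads_to_partition[of H Y P] by (auto simp: partition_on_def)
  then have "Ts = {||}" using assms(7) by (simp add: bot_fset.rep_eq fset_inject[symmetric])
  then show ?thesis using True assms is_construct.single by blast
next
  case False
  then show ?thesis using assms is_construct.branch[of H Y P f Ts] by blast
qed

lemma leads_to_carrier: "atomic_hyp H \<Longrightarrow> leads_to H (\<Union>H) {}"
  by (auto simp: leads_to_iff partition_on_empty restr_def hypergraph_on_def)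

text \<open>The leaf is absorbed as \<open>Y = \<Union>H\<close>, \<open>P = {}\<close>, so later
  inductions have a single case.\<close>

lemma construct_induct [consumes 2, case_names Node]:
  assumes "is_construct H T" "atomic_hyp H"
    and step: "\<And>H Y P f Ts. atomic_hyp H \<Longrightarrow> hyp_connected H \<Longrightarrow> Y \<noteq> {} \<Longrightarrow> Y \<subseteq> \<Union>H \<Longrightarrow>
      leads_to H Y P \<Longrightarrow> (\<forall>K\<in>P. is_construct (restr H K) (f K)) \<Longrightarrow>
      fset Ts = f ` P \<Longrightarrow> (\<And>K. K \<in> P \<Longrightarrow> Q (restr H K) (f K)) \<Longrightarrow> Q H (Node Y Ts)"
  shows "Q H T"
  using assms(1,2)
proof (induction rule: is_construct.induct)
  case (single H)
  then show ?case using step[of H "\<Union>H" "{}" _ "{||}"] leads_to_carrier[of H] by simp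
next
  case (branch H Y P f Ts)
  then show ?case using step[of H Y P f Ts] atomic_hyp_restr[of H] by blast
qed

lemma construct_cases:
  assumes "is_construct H T" "atomic_hyp H"
  obtains Y P f Ts where "T = Node Y Ts" "hyp_connected H" "Y \<noteq> {}" "Y \<subseteq> \<Union>H"
    "leads_to H Y P" "\<forall>K\<in>P. is_construct (restr H K) (f K)" "fset Ts = f ` P"
proof -
  have "\<exists>Y P f Ts. T = Node Y Ts \<and> hyp_connected H \<and> Y \<noteq> {} \<and> Y \<subseteq> \<Union>H \<and>
    leads_to H Y P \<and> (\<forall>K\<in>P. is_construct (restr H K) (f K)) \<and> fset Ts = f ` P"
    using assms by (induction rule: construct_induct) blast
  then show thesis using that by blast
qed

lemma up_construct:
  assumes "is_construct H T" "atomic_hyp H"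
  shows "up T = \<Union>H"
  using assms
proof (induction rule: construct_induct)
  case (Node H Y P f Ts)
  have pt: "partition_on (\<Union>H - Y) P" using Node by (simp add: leads_to_partition)
  have "up (f K) = K" if "K \<in> P" for K
  proof -
    have "K \<subseteq> \<Union>H" using leads_to_subset[OF _ Node(5) that] Node(1) by blast
    then show ?thesis using Node(8)[OF that] Union_restr[of H K] Node(1) by simp
  qed
  then have "up (Node Y Ts) = Y \<union> \<Union>P" by (simp add: up_Node Node(7))
  then show ?case using pt Node(4) by (auto simp: partition_on_def)
qed

lemma psi_construct_Node:
  assumes "atomic_hyp H" "hyp_connected H" "Y \<noteq> {}" "Y \<subseteq> \<Union>H" "leads_to H Y P"
    and "\<forall>K\<in>P. is_construct (restr H K) (f K)" "fset Ts = f ` P"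
  shows "psi (Node Y Ts) = insert (\<Union>H) (\<Union>K\<in>P. psi (f K))"
  using up_construct[OF is_construct_Node[OF assms] assms(1)]
  by (simp add: psi_Node assms(7))

lemma psi_Sat:
  assumes "is_construct H T" "atomic_hyp H"
  shows "psi T \<subseteq> Sat H"
  using assms
proof (induction rule: construct_induct)
  case (Node H Y P f Ts)
  have "psi (f K) \<subseteq> Sat H" if "K \<in> P" for K
    using Node(8)[OF that] Sat_restr[of H K] leads_to_subset[OF _ Node(5) that] Node(1) by auto
  moreover have "\<Union>H \<in> Sat H" using Node(3,4) by (intro Union_in_Sat[OF Node(2)]) blast
  ultimately show ?case unfolding psi_construct_Node[OF Node(1-7)] by (simp add: UN_subset_iff)
qed

lemma psi_component:
  assumes "atomic_hyp H" "leads_to H Y P" "K \<in> P" "is_construct (restr H K) T"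
  shows "up T = K" "psi T \<subseteq> {A \<in> Sat H. A \<subseteq> K}" "K \<in> psi T"
proof -
  have K: "K \<subseteq> \<Union>H" using assms(1) leads_to_subset[OF _ assms(2,3)] by blast
  show *: "up T = K"
    using up_construct[OF assms(4) atomic_hyp_restr[OF assms(1)]] Union_restr[OF _ K] assms(1) by simp
  show "psi T \<subseteq> {A \<in> Sat H. A \<subseteq> K}"
    using psi_Sat[OF assms(4) atomic_hyp_restr[OF assms(1)]] Sat_restr[OF _ K] assms(1) by simp
  show "K \<in> psi T" using * up_in_psi[of T] by simp
qed

text \<open>Recovers the root label from \<open>psi\<close>: every proper member lies in a
  component, and every component is itself a member.\<close>

lemma Union_psi_proper:
  assumes "atomic_hyp H" "hyp_connected H" "Y \<noteq> {}" "Y \<subseteq> \<Union>H" "leads_to H Y P"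
    and "\<forall>K\<in>P. is_construct (restr H K) (f K)" "fset Ts = f ` P"
  shows "\<Union>(psi (Node Y Ts) - {\<Union>H}) = \<Union>H - Y"
proof -
  have P: "\<Union>P = \<Union>H - Y" using partition_onD1[OF leads_to_partition[OF _ assms(5)]] assms(1) by simp
  have *: "psi (f K) \<subseteq> {A \<in> Sat H. A \<subseteq> K}" "K \<in> psi (f K)" if "K \<in> P" for K
    using psi_component[OF assms(1,5) that bspec[OF assms(6) that]] by auto
  have "\<not> \<Union>H \<subseteq> K" if "K \<in> P" for K
    using leads_to_subset[OF _ assms(5) that] assms(1,3,4) by blast
  then have "\<Union>H \<notin> (\<Union>K\<in>P. psi (f K))" using *(1) by blast
  then have "psi (Node Y Ts) - {\<Union>H} = (\<Union>K\<in>P. psi (f K))"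
    unfolding psi_construct_Node[OF assms] by (rule Diff_insert_absorb)
  then have "\<Union>(psi (Node Y Ts) - {\<Union>H}) = (\<Union>K\<in>P. \<Union>(psi (f K)))"
    by auto
  also have "\<dots> = \<Union>P" using * by blast
  finally show ?thesis using P by simp
qed

text \<open>Recovers \<open>psi\<close> of a child: a non-empty member inside \<open>K\<close>
  cannot come from another component, and the carrier is not inside \<open>K\<close> because
  \<open>Y\<close> is non-empty.\<close>

lemma psi_child:
  assumes "atomic_hyp H" "hyp_connected H" "Y \<noteq> {}" "Y \<subseteq> \<Union>H" "leads_to H Y P"
    and "\<forall>K\<in>P. is_construct (restr H K) (f K)" "fset Ts = f ` P" and K: "K \<in> P"
  shows "psi (f K) = {A \<in> psi (Node Y Ts). A \<subseteq> K}"
proof -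
  have pt: "partition_on (\<Union>H - Y) P" using assms leads_to_partition[of H Y P] by blast
  have *: "psi (f K) \<subseteq> {A \<in> Sat H. A \<subseteq> K}" if "K \<in> P" for K
    using psi_component[OF assms(1,5) that bspec[OF assms(6) that]] by auto
  have n: "\<not> \<Union>H \<subseteq> K" using leads_to_subset[OF _ assms(5) K] assms(1,3,4) by blast
  note ps = psi_construct_Node[OF assms(1-7)]
  show ?thesis
  proof (intro subset_antisym subsetI)
    fix A assume "A \<in> {A \<in> psi (Node Y Ts). A \<subseteq> K}"
    then have A: "A \<subseteq> K" "A \<in> insert (\<Union>H) (\<Union>K\<in>P. psi (f K))" by (simp_all add: ps)
    then have "A \<noteq> \<Union>H" using n by metis
    then obtain L where L: "L \<in> P" "A \<in> psi (f L)" using A(2) by blast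
    then have "A \<noteq> {}" "A \<subseteq> L" using *[OF L(1)] by (auto simp: Sat_def)
    then have "L = K" using A(1) partition_on_block_unique[OF pt L(1) K] by blast
    then show "A \<in> psi (f K)" using L(2) by simp
  next
    fix A assume "A \<in> psi (f K)"
    then show "A \<in> {A \<in> psi (Node Y Ts). A \<subseteq> K}" unfolding ps using *[OF K] K by blast
  qed
qed

text \<open>\<open>psi\<close> determines the root label, hence the components, hence
  \<open>psi\<close> of each child; induction down the tree does the rest.\<close>

lemma psi_inj:
  assumes "is_construct H S" "atomic_hyp H" "is_construct H T" "psi S = psi T"
  shows "S = T"
  using assms
proof (induction arbitrary: T rule: construct_induct)
  case (Node H Y P f Ts)
  from construct_cases[OF Node(9) Node(1)] obtain Y' P' f' Ts' where
    T: "T = Node Y' Ts'" "hyp_connected H" "Y' \<noteq> {}" "Y' \<subseteq> \<Union>H"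
    "leads_to H Y' P'" "\<forall>K\<in>P'. is_construct (restr H K) (f' K)" "fset Ts' = f' ` P'" by metis
  have "\<Union>H - Y = \<Union>H - Y'"
    using Union_psi_proper[OF Node(1-7)] Union_psi_proper[OF Node(1) T(2-7)] Node(10) T(1) by simp
  then have Y: "Y' = Y" using T(4) Node(4) by blast
  then have P: "P' = P" using leads_to_unique Node(1,5) T(5) by blast
  have "f K = f' K" if "K \<in> P" for K
  proof (rule Node(8)[OF that])
    show "is_construct (restr H K) (f' K)" using T(6) that P by simp
    show "psi (f K) = psi (f' K)"
      using psi_child[OF Node(1-7) that] psi_child[OF Node(1) T(2-7), of K] that P Node(10) T(1) by simp
  qed
  then have "fset Ts = fset Ts'" using Node(7) T(7) P by (auto simp: image_def)
  then show ?case using T(1) Y by (simp add: fset_inject)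
qed

text \<open>For two members the closure condition says that one contains the other or their union is
  not connected. The form for arbitrary families is what the estimate
  \<open>sum_Union_le_power3\<close> delivers for tight inequalities.\<close>

definition nested :: "'a set set \<Rightarrow> 'a set set \<Rightarrow> bool" where
  "nested H N \<longleftrightarrow> N \<subseteq> Sat H \<and> \<Union>H \<in> N \<and>
     (\<forall>F\<subseteq>N. F \<noteq> {} \<longrightarrow> \<Union>F \<in> Sat H \<longrightarrow> \<Union>F \<in> F)"

text \<open>The tree is built from the root by induction on the size of the carrier. The closure
  condition serves twice: it leaves something for the root label, and it puts the components into
  \<open>N\<close>.\<close>

lemma nested_construct:
  assumes "atomic_hyp H" "nested H N"
  shows "\<exists>T. is_construct H T \<and> psi T = N"
  using assms
proof (induction "card (\<Union>H)" arbitrary: H N rule: less_induct)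
  case less
  have at: "atomic H" and fin: "finite (\<Union>H)" using less.prems by (auto simp: hypergraph_on_def)
  have N: "N \<subseteq> Sat H" "\<Union>H \<in> N" and clos: "\<And>F. F \<subseteq> N \<Longrightarrow> F \<noteq> {} \<Longrightarrow> \<Union>F \<in> Sat H \<Longrightarrow> \<Union>F \<in> F"
    using less.prems(2) by (auto simp: nested_def)
  have U: "\<Union>H \<in> Sat H" using N by auto
  then have con: "hyp_connected H" "\<Union>H \<noteq> {}" by (auto simp: Sat_def restr_Union)
  define Y where "Y = \<Union>H - \<Union>(N - {\<Union>H})"
  \<comment> \<open>If the proper members covered the carrier, their union would be connected
    without being one of them.\<close>
  have "Y \<noteq> {}"
  proof
    assume "Y = {}"
    then have "\<Union>(N - {\<Union>H}) = \<Union>H" using N(1) by (auto simp: Y_def Sat_def)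
    then show False using clos[of "N - {\<Union>H}"] U con(2) by (cases "N - {\<Union>H} = {}") auto
  qed
  have YH: "Y \<subseteq> \<Union>H" by (auto simp: Y_def)
  obtain P where P: "leads_to H Y P" using leads_to_exists[OF less.prems(1)] by blast
  have pt: "partition_on (\<Union>H - Y) P" using leads_to_partition[OF at P] .
  have inc: "\<exists>K\<in>P. A \<subseteq> K" if "A \<in> N - {\<Union>H}" for A
  proof -
    have "A \<in> Sat H" "A \<inter> Y = {}" using that N(1) by (auto simp: Y_def)
    then show ?thesis using Sat_in_component[OF at P] by metis
  qed
  have PN: "K \<in> N" if K: "K \<in> P" for K
  proof -
    \<comment> \<open>Each point of \<open>K\<close> lies in a proper member, and that member lies
      within one component, necessarily \<open>K\<close>. So \<open>?F\<close> covers the connected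
      set \<open>K\<close>, which must then belong to \<open>?F\<close>.\<close>
    let ?F = "{A \<in> N - {\<Union>H}. A \<subseteq> K}"
    have "K \<subseteq> \<Union>?F"
    proof
      fix i assume i: "i \<in> K"
      then have "i \<in> \<Union>(N - {\<Union>H})" using K pt unfolding partition_on_def Y_def by blast
      then obtain A where A: "A \<in> N - {\<Union>H}" "i \<in> A" by blast
      then obtain L where "L \<in> P" "A \<subseteq> L" using inc by blast
      moreover from this have "L = K" using partition_on_block_unique[OF pt _ K, of L] i A by blast
      ultimately show "i \<in> \<Union>?F" using A by auto
    qed
    then have e: "\<Union>?F = K" by auto
    have KS: "K \<in> Sat H" using leads_to_Sat[OF at P] K by auto
    then have "\<Union>?F \<noteq> {}" unfolding e by (simp add: Sat_def)
    then have "?F \<noteq> {}" by (metis Union_empty)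
    then have "\<Union>?F \<in> ?F" using KS by (intro clos) (auto simp only: e)
    then have "K \<in> ?F" unfolding e .
    then show ?thesis by auto
  qed
  have "\<exists>T. is_construct (restr H K) T \<and> psi T = {A \<in> N. A \<subseteq> K}" if K: "K \<in> P" for K
  proof (rule less.hyps)
    have KH: "K \<subset> \<Union>H" using leads_to_subset[OF at P K] \<open>Y \<noteq> {}\<close> YH by blast
    then have UK: "\<Union>(restr H K) = K" using Union_restr[OF at] by blast
    show "card (\<Union>(restr H K)) < card (\<Union>H)" unfolding UK using fin KH by (rule psubset_card_mono)
    show "atomic_hyp (restr H K)" using less.prems(1) by (rule atomic_hyp_restr)
    have S: "Sat (restr H K) = {A \<in> Sat H. A \<subseteq> K}" using Sat_restr[OF at] KH by blast
    show "nested (restr H K) {A \<in> N. A \<subseteq> K}"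
      unfolding nested_def S UK
    proof (intro conjI allI impI)
      fix F assume "F \<subseteq> {A \<in> N. A \<subseteq> K}" "F \<noteq> {}" "\<Union>F \<in> {A \<in> Sat H. A \<subseteq> K}"
      then show "\<Union>F \<in> F" by (intro clos) auto
    qed (use PN[OF K] N(1) in auto)
  qed
  then obtain f where f: "\<forall>K\<in>P. is_construct (restr H K) (f K)"
    "\<And>K. K \<in> P \<Longrightarrow> psi (f K) = {A \<in> N. A \<subseteq> K}" by metis
  have "finite P" using leads_to_finite[OF less.prems(1) P] .
  then have fs: "fset (Abs_fset (f ` P)) = f ` P" by (simp add: Abs_fset_inverse)
  have "psi (Node Y (Abs_fset (f ` P))) = insert (\<Union>H) (\<Union>K\<in>P. psi (f K))"
    using psi_construct_Node[OF less.prems(1) con(1) \<open>Y \<noteq> {}\<close> YH P f(1) fs] .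
  also have "\<dots> = insert (\<Union>H) (\<Union>K\<in>P. {A \<in> N. A \<subseteq> K})" using f(2) by simp
  also have "\<dots> = N"
  proof (intro subset_antisym subsetI)
    fix A assume "A \<in> N"
    then show "A \<in> insert (\<Union>H) (\<Union>K\<in>P. {A \<in> N. A \<subseteq> K})"
      using inc[of A] by (cases "A = \<Union>H") blast+
  qed (use N(2) in blast)
  finally show ?case
    using is_construct_Node[OF less.prems(1) con(1) \<open>Y \<noteq> {}\<close> YH P f(1) fs] by blast
qed

section \<open>The order on constructs\<close>

text \<open>Contracting an edge can only drop the member at its lower end. Equality of
  \<open>up\<close> is carried along to keep the top member fixed in the case
  \<open>inside\<close>.\<close>

lemma construct_le_psi: "construct_le H S T \<Longrightarrow> up S = up T \<and> psi T \<subseteq> psi S"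
proof (induction rule: construct_le.induct)
  case (contract H Y P K1 X Q U Us T Ts)
  have "up (Node Y (finsert (Node X Us) Ts)) = up (Node (Y \<union> X) (Us |\<union>| Ts))"
    by (auto simp: up_Node)
  then show ?case by (auto simp: psi_Node)
next
  case (inside H Y P K1 T Ts S S')
  then have "up (Node Y (finsert S Ts)) = up (Node Y (finsert S' Ts))"
    by (auto simp: up_Node)
  with inside show ?case by (auto simp: psi_Node)
qed auto

text \<open>A hyperedge avoiding \<open>Y\<close> and \<open>X\<close> lies in one component of the
  complement of \<open>Y\<close>; if that is \<open>K1\<close>, it lies in one of the components of
  \<open>K1 - X\<close>. Hence contracted trees are again constructs.\<close>

lemma leads_to_contract:
  assumes at: "atomic H" and P: "leads_to H Y P" and K1: "K1 \<in> P" and X: "X \<subseteq> K1"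
    and Q: "leads_to (restr H K1) X Q"
  shows "leads_to H (Y \<union> X) (Q \<union> (P - {K1}))"
proof -
  have pt: "partition_on (\<Union>H - Y) P" and ed: "restr H (\<Union>H - Y) = (\<Union>K\<in>P. restr H K)"
    and c: "\<forall>K\<in>P. hyp_connected (restr H K)"
    using P at by (auto simp: leads_to_iff)
  have KHY: "K1 \<subseteq> \<Union>H - Y" using leads_to_subset[OF at P K1] .
  then have KH: "K1 \<subseteq> \<Union>H" by blast
  have UK: "\<Union>(restr H K1) = K1" using Union_restr[OF at KH] .
  have atK: "atomic (restr H K1)" using at by (auto simp: atomic_def restr_def)
  have ptQ: "partition_on (K1 - X) Q"
    using leads_to_partition[OF atK Q] UK by simp
  then have sub: "L \<subseteq> K1" if "L \<in> Q" for L using that by (auto simp: partition_on_def)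
  have r: "restr (restr H K1) L = restr H L" if "L \<in> Q" for L
    using restr_restr[OF sub[OF that]] .
  have edQ: "restr H (K1 - X) = (\<Union>K\<in>Q. restr H K)" and cQ: "\<forall>K\<in>Q. hyp_connected (restr H K)"
    using Q r unfolding leads_to_iff[OF atK] UK by (simp_all add: restr_restr)
  have "partition_on (\<Union>H - Y - K1) (P - {K1})"
  proof (rule partition_onI)
    have "K \<inter> K1 = {}" if "K \<in> P - {K1}" for K
      using that partition_on_block_unique[OF pt _ K1, of K] by blast
    then have "\<Union>(P - {K1}) = \<Union>P - K1" using K1 by blast
    then show "\<Union>(P - {K1}) = \<Union>H - Y - K1" using partition_onD1[OF pt] by simp
  next
    fix K L assume "K \<in> P - {K1}" "L \<in> P - {K1}" "K \<noteq> L"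
    then show "disjnt K L" using disjointD[OF partition_onD2[OF pt]] by (simp add: disjnt_def)
  next
    show "{} \<notin> P - {K1}" using partition_onD3[OF pt] by simp
  qed
  then have part: "partition_on ((K1 - X) \<union> (\<Union>H - Y - K1)) (Q \<union> (P - {K1}))"
    using ptQ by (intro partition_on_disjoint_Un) auto
  have e: "(K1 - X) \<union> (\<Union>H - Y - K1) = \<Union>H - (Y \<union> X)"
    using X KHY by blast
  have "restr H (\<Union>H - (Y \<union> X)) = (\<Union>K\<in>Q \<union> (P - {K1}). restr H K)" (is "?l = ?r")
  proof
    show "?l \<subseteq> ?r"
    proof
      fix Z assume Z: "Z \<in> ?l"
      then have "Z \<in> restr H (\<Union>H - Y)" by (auto simp: restr_def)
      then obtain K where K: "K \<in> P" "Z \<in> restr H K" using ed by auto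
      show "Z \<in> ?r"
      proof (cases "K = K1")
        case True
        then have "Z \<in> restr H (K1 - X)" using K Z by (auto simp: restr_def)
        then show ?thesis using edQ by auto
      qed (use K in auto)
    qed
    have "L \<subseteq> \<Union>H - (Y \<union> X)" if "L \<in> Q \<union> (P - {K1})" for L
      using that partition_onD1[OF part] unfolding e by blast
    then show "?r \<subseteq> ?l" by (intro UN_least) (auto simp: restr_def)
  qed
  then show ?thesis using c cQ part unfolding leads_to_iff[OF at] e by blast
qed

text \<open>\<open>B\<close> comes from exactly one child, on a component \<open>K\<close>. If
  \<open>B\<close> is not \<open>K\<close>, induction and the rule \<open>inside\<close> apply; if
  \<open>B = K\<close>, the edge from the root to that child is contracted.\<close>

lemma construct_remove:
  assumes "is_construct H S" "atomic_hyp H" "B \<in> psi S" "B \<noteq> \<Union>H"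
  shows "\<exists>S'. is_construct H S' \<and> construct_le H S S' \<and> psi S' = psi S - {B}"
  using assms
proof (induction rule: construct_induct)
  case (Node H Y P f Ts)
  note ps = psi_construct_Node[OF Node(1-7)]
  have pt: "partition_on (\<Union>H - Y) P" using Node by (simp add: leads_to_partition)
  obtain K where K: "K \<in> P" "B \<in> psi (f K)" using Node(9,10) ps by auto
  have KHY: "K \<subseteq> \<Union>H - Y" using leads_to_subset[OF _ Node(5) K(1)] Node(1) by blast
  moreover have "K \<noteq> {}" using partition_onD3[OF pt] K(1) by blast
  ultimately have YH: "Y \<subset> \<Union>H" using Node(4) by blast
  have KH: "K \<subseteq> \<Union>H" using KHY by blast
  have UK: "\<Union>(restr H K) = K" using Union_restr KH Node(1) by blast
  have ahK: "atomic_hyp (restr H K)" using Node(1) by (rule atomic_hyp_restr)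
  have "B \<noteq> {}" "B \<subseteq> K" using psi_component(2)[OF Node(1,5) K(1) bspec[OF Node(6) K(1)]] K(2) by (auto simp: Sat_def)
  then have BL: "B \<notin> psi (f L)" if "L \<in> P" "L \<noteq> K" for L
    using psi_component(2)[OF Node(1,5) that(1) bspec[OF Node(6) that(1)]] that
      partition_on_block_unique[OF pt that(1) K(1)] by blast
  let ?C = "\<Union>L\<in>P - {K}. psi (f L)"
  have split: "(\<Union>L\<in>P. g L) = g K \<union> (\<Union>L\<in>P - {K}. g L)" for g :: "'a set \<Rightarrow> 'a set set"
    using K(1) by blast
  have ps': "psi (Node Y Ts) = insert (\<Union>H) (psi (f K) \<union> ?C)"
    using ps split[of "\<lambda>L. psi (f L)"] by simp
  have BC: "B \<notin> ?C" using BL by blast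
  have rem: "insert u ((A - {b}) \<union> C) = insert u (A \<union> C) - {b}" if "b \<noteq> u" "b \<notin> C"
    for u b :: "'a set" and A C using that by blast
  have finP: "finite P" using leads_to_finite Node(1,5) by blast
  define R where "R = Abs_fset (f ` (P - {K}))"
  have R: "fset R = f ` (P - {K})" using finP by (simp add: R_def Abs_fset_inverse)
  have TsR: "Ts = finsert (f K) R" using K(1) Node(7) R by (auto simp: fset_inject[symmetric])
  have constr: "\<forall>L\<in>P - {K}. is_construct (restr H L) (f L)" using Node(6) by auto
  show ?case
  proof (cases "B = K")
    case False
    then obtain S' where S': "is_construct (restr H K) S'" "construct_le (restr H K) (f K) S'"
      "psi S' = psi (f K) - {B}"
      using Node(8)[OF K] UK by auto
    let ?f = "f(K := S')"
    have fs: "fset (finsert S' R) = ?f ` P" using R K(1) by auto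
    have c: "\<forall>L\<in>P. is_construct (restr H L) (?f L)" using S'(1) Node(6) by auto
    have "psi (Node Y (finsert S' R)) = insert (\<Union>H) (\<Union>L\<in>P. psi (?f L))"
      using psi_construct_Node[OF Node(1-5) c fs] .
    also have "(\<Union>L\<in>P. psi (?f L)) = (psi (f K) - {B}) \<union> ?C"
      using split[of "\<lambda>L. psi (?f L)"] S'(3) by simp
    also have "insert (\<Union>H) \<dots> = psi (Node Y Ts) - {B}"
      unfolding ps' using rem BC Node(10) by metis
    finally show ?thesis
      using is_construct_Node[OF Node(1-5) c fs]
        construct_le.inside[OF Node(2,3) YH Node(5) K(1) constr R S'(2)] TsR by blast
  next
    case True
    obtain X Q g Us where fK: "f K = Node X Us" "hyp_connected (restr H K)" "X \<noteq> {}"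
      "X \<subseteq> \<Union>(restr H K)" "leads_to (restr H K) X Q"
      "\<forall>L\<in>Q. is_construct (restr (restr H K) L) (g L)" "fset Us = g ` Q"
      by (rule construct_cases[OF bspec[OF Node(6) K(1)] ahK])
    have XK: "X \<subseteq> K" using fK(4) UK by simp
    have ptQ: "partition_on (K - X) Q" using leads_to_partition[of "restr H K" X Q] ahK fK(5) UK by simp
    have QK: "L \<subset> K" if "L \<in> Q" for L using partition_onD1[OF ptQ] that fK(3) XK by blast
    have g: "is_construct (restr H L) (g L)" if "L \<in> Q" for L
      using bspec[OF fK(6) that] QK[OF that] by (simp add: restr_restr)
    have lt: "leads_to H (Y \<union> X) (Q \<union> (P - {K}))"
      using leads_to_contract[OF _ Node(5) K(1) XK fK(5)] Node(1) by blast
    let ?h = "\<lambda>L. if L \<in> Q then g L else f L"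
    \<comment> \<open>The two families of components do not clash, so \<open>?h\<close> is
      \<open>f\<close> on the old ones: blocks of \<open>Q\<close> lie in \<open>K\<close>, the
      others are disjoint from it.\<close>
    have dis: "L \<notin> Q" if "L \<in> P - {K}" for L
    proof
      assume "L \<in> Q"
      then have "L \<subseteq> K" "L \<noteq> {}" using QK partition_onD3[OF ptQ] by blast+
      then show False using that partition_on_block_unique[OF pt K(1), of L] by blast
    qed
    have fs: "fset (Us |\<union>| R) = ?h ` (Q \<union> (P - {K}))"
    proof -
      have "?h ` (P - {K}) = f ` (P - {K})" using dis by (intro image_cong) simp_all
      then show ?thesis unfolding image_Un using R fK(7) by simp
    qed
    have h: "\<forall>L\<in>Q \<union> (P - {K}). is_construct (restr H L) (?h L)"
      using g Node(6) by auto
    have YX: "Y \<union> X \<noteq> {}" "Y \<union> X \<subseteq> \<Union>H" using Node(3,4) XK KH by blast+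
    have psK: "psi (f K) = insert K (\<Union>L\<in>Q. psi (g L))"
      using psi_construct_Node[OF ahK fK(2-7)] fK(1) UK by simp
    have "A \<subset> K" if "L \<in> Q" "A \<in> psi (g L)" for A L
    proof -
      have "A \<subseteq> L" using psi_component(2)[OF ahK fK(5) that(1) bspec[OF fK(6) that(1)]] that(2) by auto
      then show ?thesis using QK[OF that(1)] by auto
    qed
    \<comment> \<open>So \<open>K\<close> is the only member that the contraction loses: those below
      it are proper subsets of \<open>K\<close> and survive.\<close>
    then have KQ: "K \<notin> (\<Union>L\<in>Q. psi (g L))" by blast
    have "psi (Node (Y \<union> X) (Us |\<union>| R)) = insert (\<Union>H) (\<Union>L\<in>Q \<union> (P - {K}). psi (?h L))"
      using psi_construct_Node[OF Node(1,2) YX lt h fs] .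
    also have "(\<Union>L\<in>Q \<union> (P - {K}). psi (?h L)) = (psi (f K) - {B}) \<union> ?C"
    proof -
      have "(\<Union>L\<in>P - {K}. psi (?h L)) = ?C" using dis by (intro SUP_cong) simp_all
      moreover have "(\<Union>L\<in>Q. psi (?h L)) = psi (f K) - {B}"
        unfolding psK True Diff_insert_absorb[OF KQ] by simp
      ultimately show ?thesis unfolding UN_Un by simp
    qed
    also have "insert (\<Union>H) \<dots> = psi (Node Y Ts) - {B}"
      unfolding ps' using rem BC Node(10) by metis
    finally have "psi (Node (Y \<union> X) (Us |\<union>| R)) = psi (Node Y Ts) - {B}" .
    moreover have "construct_le H (Node Y Ts) (Node (Y \<union> X) (Us |\<union>| R))"
      unfolding TsR fK(1)
      using g by (intro construct_le.contract[OF Node(2,3) YH Node(5) K(1) fK(3) XK fK(5) _ fK(7) constr R]) blast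
    ultimately show ?thesis using is_construct_Node[OF Node(1,2) YX lt h fs] by blast
  qed
qed

lemma finite_Sat: "atomic_hyp H \<Longrightarrow> finite (Sat H)"
  by (rule finite_subset[of _ "Pow (\<Union>H)"]) (auto simp: Sat_def hypergraph_on_def)

text \<open>For the converse, surplus members of \<open>psi S\<close> are removed one at a time by
  going up in the order; once the nested sets agree, injectivity of \<open>psi\<close> identifies
  the trees.\<close>

lemma construct_le_iff:
  assumes ah: "atomic_hyp H" and S: "is_construct H S" and T: "is_construct H T"
  shows "construct_le H S T \<longleftrightarrow> psi T \<subseteq> psi S"
proof
  show "construct_le H S T \<Longrightarrow> psi T \<subseteq> psi S" using construct_le_psi by blast
  have "construct_le H S T" if "is_construct H S" "psi T \<subseteq> psi S" for S
    using that
  proof (induction "card (psi S)" arbitrary: S rule: less_induct)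
    case less
    show ?case
    proof (cases "psi S = psi T")
      case True
      then show ?thesis using psi_inj[OF less.prems(1) ah T] construct_le.refl[OF T] by simp
    next
      case False
      then obtain B where B: "B \<in> psi S" "B \<notin> psi T" using less.prems by blast
      then have "B \<noteq> \<Union>H" using up_in_psi[of T] up_construct[OF T ah] by auto
      then obtain S' where S': "is_construct H S'" "construct_le H S S'" "psi S' = psi S - {B}"
        using construct_remove[OF less.prems(1) ah B(1)] by blast
      have "finite (psi S)" using psi_Sat[OF less.prems(1) ah] finite_Sat[OF ah] finite_subset by blast
      then have "card (psi S') < card (psi S)" using S'(3) B(1) by (metis card_Diff1_less)
      then have "construct_le H S' T" using less.hyps S' less.prems(2) B(2) by blast
      then show ?thesis using S'(2) construct_le.trans by blast
    qed
  qed
  then show "psi T \<subseteq> psi S \<Longrightarrow> construct_le H S T" using S by blast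
qed

section \<open>Points of the realisation\<close>

text \<open>Rests on \<open>p + q \<le> p * q\<close> for \<open>p, q \<ge> 3\<close>, obtained from
  the product of \<open>p - 2\<close> and \<open>q - 2\<close>. It bounds the mass used by the
  children of a node.\<close>

lemma sum_power3_le:
  fixes c :: "'b \<Rightarrow> nat"
  assumes "finite P" "\<And>K. K \<in> P \<Longrightarrow> c K \<ge> 1"
  shows "(\<Sum>K\<in>P. 3 ^ c K :: real) \<le> 3 ^ (\<Sum>K\<in>P. c K)"
  using assms
proof (induction P rule: finite_induct)
  case (insert K P)
  show ?case
  proof (cases "P = {}")
    case False
    then obtain L where "L \<in> P" by blast
    then have "1 \<le> c L" "c L \<le> sum c P" using insert by (auto intro: member_le_sum)
    then have 1: "(3::real) ^ 1 \<le> 3 ^ sum c P" by (intro power_increasing) auto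
    have 2: "(3::real) ^ 1 \<le> 3 ^ c K" using insert by (intro power_increasing) auto
    have "0 \<le> ((3::real) ^ c K - 2) * (3 ^ sum c P - 2)" using 1 2 by (intro mult_nonneg_nonneg) auto
    then have "(3::real) ^ c K + 3 ^ sum c P \<le> 3 ^ c K * 3 ^ sum c P"
      using 1 2 by (simp add: algebra_simps)
    then show ?thesis using insert by (simp add: power_add)
  qed simp
qed simp

text \<open>Here \<open>a\<close> and \<open>k\<close> count the points of a root label inside and
  outside a connected set of size \<open>c\<close>, and \<open>r\<close> counts the points below the
  root. Divided by \<open>a + k\<close>, it says that the \<open>a\<close> root points alone carry
  more than \<open>3 ^ c\<close>. The bound \<open>c < a + k + r\<close> matters when
  \<open>k = 0\<close>: then \<open>3 ^ c\<close> and \<open>3 ^ r\<close> are each at most a third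
  of \<open>3 ^ (a + r)\<close>.\<close>

lemma weight_inequality:
  fixes a k r c :: nat
  assumes "a \<ge> 1" "c \<le> a + r" "c < a + k + r"
  shows "real (a + k) * 3 ^ c < real a * (3 ^ (a + k + r) - 3 ^ r)"
proof (cases "k = 0")
  case True
  have "3 * (3::real) ^ c \<le> 3 ^ (a + r)"
    using power_increasing[of "Suc c" "a + r" "3::real"] assms True by simp
  moreover have "3 * (3::real) ^ r \<le> 3 ^ (a + r)"
    using power_increasing[of "Suc r" "a + r" "3::real"] assms by simp
  moreover have "(0::real) < 3 ^ (a + r)" by simp
  ultimately have "(3::real) ^ c < 3 ^ (a + r) - 3 ^ r" by linarith
  then show ?thesis using assms True by simp
next
  case False
  \<comment> \<open>Compared with the factor \<open>1 + k\<close> needed below, this leaves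
    \<open>k * 3 ^ (a + r)\<close> to spare, which exceeds \<open>3 ^ r\<close>.\<close>
  have kp: "1 + 2 * real k \<le> 3 ^ k"
    using Bernoulli_inequality[of 2 k] by (simp add: mult.commute)
  have "real (a + k) \<le> real a * (1 + real k)"
    using mult_right_mono[of 1 "real a" "real k"] assms by (simp add: algebra_simps)
  then have "real (a + k) * 3 ^ c \<le> real a * (1 + real k) * 3 ^ (a + r)"
    using assms by (intro mult_mono power_increasing) auto
  also have "\<dots> = real a * ((1 + real k) * 3 ^ (a + r))" by simp
  also have "\<dots> < real a * (3 ^ (a + k + r) - 3 ^ r)"
  proof (rule mult_strict_left_mono)
    have "(3::real) ^ r < 3 ^ (a + r)" using assms by (intro power_strict_increasing) auto
    also have "\<dots> \<le> real k * 3 ^ (a + r)" using False by simp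
    finally have "(1 + real k) * 3 ^ (a + r) + 3 ^ r < (1 + 2 * real k) * 3 ^ (a + r)"
      by (simp add: algebra_simps)
    also have "\<dots> \<le> 3 ^ k * 3 ^ (a + r)" using kp by (intro mult_right_mono) auto
    finally show "(1 + real k) * 3 ^ (a + r) < 3 ^ (a + k + r) - 3 ^ r"
      by (simp add: power_add algebra_simps)
  qed (use assms in simp)
  finally show ?thesis .
qed

lemma construct_point:
  assumes "is_construct H T" "atomic_hyp H"
  shows "\<exists>x::'a \<Rightarrow> real. (\<forall>i\<in>\<Union>H. x i > 0) \<and> (\<forall>A\<in>psi T. sum x A = 3 ^ card A) \<and>
    (\<forall>A\<in>Sat H - psi T. sum x A > 3 ^ card A)"
  using assms
proof (induction rule: construct_induct)
  case (Node H Y P f Ts)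
  have at: "atomic H" and fin: "finite (\<Union>H)" using Node(1) by (auto simp: hypergraph_on_def)
  have pt: "partition_on (\<Union>H - Y) P" using leads_to_partition[OF at Node(5)] .
  note sub = leads_to_subset[OF at Node(5)] and uniq = partition_on_block_unique[OF pt]
  note UP = partition_onD1[OF pt, symmetric]
  have UK: "\<Union>(restr H K) = K" and SK: "Sat (restr H K) = {A \<in> Sat H. A \<subseteq> K}" if "K \<in> P" for K
  proof -
    have "K \<subseteq> \<Union>H" using sub[OF that] by blast
    then show "\<Union>(restr H K) = K" "Sat (restr H K) = {A \<in> Sat H. A \<subseteq> K}"
      by (rule Union_restr[OF at] Sat_restr[OF at])+
  qed
  note comp = psi_component[OF Node(1,5) _ bspec[OF Node(6)]]
  note ps = psi_construct_Node[OF Node(1-7)]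
  have finP: "finite P" using leads_to_finite[OF Node(1,5)] .
  have finK: "finite K" if "K \<in> P" for K using sub[OF that] fin by (meson Diff_subset finite_subset)
  have finY: "finite Y" using Node(4) fin by (rule finite_subset)
  have "\<forall>K\<in>P. \<exists>y::'a \<Rightarrow> real. (\<forall>i\<in>K. y i > 0) \<and> (\<forall>A\<in>psi (f K). sum y A = 3 ^ card A) \<and>
    (\<forall>A\<in>{A \<in> Sat H. A \<subseteq> K} - psi (f K). sum y A > 3 ^ card A)"
    using Node(8) UK SK by simp
  then obtain y :: "'a set \<Rightarrow> 'a \<Rightarrow> real" where
    y': "\<forall>K\<in>P. (\<forall>i\<in>K. y K i > 0) \<and> (\<forall>A\<in>psi (f K). sum (y K) A = 3 ^ card A) \<and>
      (\<forall>A\<in>{A \<in> Sat H. A \<subseteq> K} - psi (f K). sum (y K) A > 3 ^ card A)"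
    unfolding bchoice_iff by (elim exE)
  have y: "\<And>K i. K \<in> P \<Longrightarrow> i \<in> K \<Longrightarrow> y K i > 0"
    "\<And>K A. K \<in> P \<Longrightarrow> A \<in> psi (f K) \<Longrightarrow> sum (y K) A = 3 ^ card A"
    "\<And>K A. K \<in> P \<Longrightarrow> A \<in> Sat H \<Longrightarrow> A \<subseteq> K \<Longrightarrow> A \<notin> psi (f K) \<Longrightarrow> sum (y K) A > 3 ^ card A"
    using y' by simp_all
  define r where "r = card (\<Union>P)"
  \<comment> \<open>The weight that brings the total to \<open>3 ^ card (\<Union>H)\<close> when
    each component \<open>K\<close> uses \<open>3 ^ card K\<close>.\<close>
  define w where "w = (3 ^ card (\<Union>H) - (\<Sum>K\<in>P. 3 ^ card K)) / real (card Y)"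
  \<comment> \<open>Glues the points of the children; the description selects the unique component
    containing \<open>i\<close>, and values off the carrier are irrelevant.\<close>
  define x where "x i = (if i \<in> Y then w else y (THE K. K \<in> P \<and> i \<in> K) i)" for i
  have xK: "x i = y K i" if "K \<in> P" "i \<in> K" for K i
  proof -
    have "(THE K. K \<in> P \<and> i \<in> K) = K" using that uniq by (intro the_equality) blast+
    moreover have "i \<notin> Y" using sub[OF that(1)] that(2) by blast
    ultimately show ?thesis by (simp add: x_def)
  qed
  have sxK: "sum x A = sum (y K) A" if "K \<in> P" "A \<subseteq> K" for K A
    using xK[OF that(1)] that(2) by (intro sum.cong) auto
  have r: "r = (\<Sum>K\<in>P. card K)"
    unfolding r_def using partition_onD2[OF pt] finK
    by (intro card_Union_disjoint) (auto simp: disjoint_def pairwise_def disjnt_def)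
  have YP: "Y \<inter> \<Union>P = {}" "Y \<union> \<Union>P = \<Union>H" unfolding UP using Node(4) by blast+
  have finU: "finite (\<Union>P)" using finP finK by simp
  have cardH: "card (\<Union>H) = card Y + r"
    unfolding r_def YP(2)[symmetric] using finY finU YP(1) by (rule card_Un_disjoint)
  have S: "(\<Sum>K\<in>P. 3 ^ card K :: real) \<le> 3 ^ r"
    unfolding r
  proof (rule sum_power3_le[OF finP])
    fix K assume "K \<in> P"
    then have "K \<noteq> {}" using partition_onD3[OF pt] by blast
    then show "1 \<le> card K" using finK[OF \<open>K \<in> P\<close>] by (simp add: Suc_le_eq card_gt_0_iff)
  qed
  have Y1: "card Y \<ge> 1" using Node(3) finY by (simp add: Suc_le_eq card_gt_0_iff)
  have "(3::real) ^ r < 3 ^ card (\<Union>H)" unfolding cardH using Y1 by (intro power_strict_increasing) auto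
  with S have "0 < 3 ^ card (\<Union>H) - (\<Sum>K\<in>P. 3 ^ card K :: real)" by linarith
  then have w0: "w > 0" unfolding w_def using Y1 by (intro divide_pos_pos) auto
  have pos: "x i > 0" if "i \<in> \<Union>H" for i
  proof (cases "i \<in> Y")
    case True
    then show ?thesis using w0 by (simp add: x_def)
  next
    case False
    have "i \<in> Y \<union> \<Union>P" unfolding YP(2) using that .
    with False obtain K where "K \<in> P" "i \<in> K" by blast
    then show ?thesis using xK y(1) by simp
  qed
  have sxY: "sum x A = real (card A) * w" if "A \<subseteq> Y" for A
  proof -
    have "sum x A = (\<Sum>i\<in>A. w)" using that by (intro sum.cong) (auto simp: x_def)
    then show ?thesis by simp
  qed
  have "sum x (\<Union>P) = (\<Sum>K\<in>P. sum x K)"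
    using finK partition_onD2[OF pt] by (subst sum.Union_disjoint) (auto simp: disjoint_def)
  also have "\<dots> = (\<Sum>K\<in>P. 3 ^ card K)"
    using sxK y(2) comp(3) by (intro sum.cong) simp_all
  finally have "sum x (\<Union>H) = real (card Y) * w + (\<Sum>K\<in>P. 3 ^ card K)"
    using sum.union_disjoint[OF finY finU YP(1), of x] sxY[of Y] YP(2) by simp
  then have top: "sum x (\<Union>H) = 3 ^ card (\<Union>H)" using Y1 by (simp add: w_def)
  have eq: "sum x A = 3 ^ card A" if "A \<in> psi (Node Y Ts)" for A
  proof (cases "A = \<Union>H")
    case False
    then have "A \<in> (\<Union>K\<in>P. psi (f K))" using that by (simp add: ps)
    then obtain K where K: "K \<in> P" "A \<in> psi (f K)" by blast
    then have "A \<subseteq> K" using comp(2) by blast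
    then show ?thesis using sxK y(2) K by simp
  qed (simp add: top)
  have gt: "sum x A > 3 ^ card A" if A: "A \<in> Sat H" "A \<notin> psi (Node Y Ts)" for A
  proof (cases "A \<inter> Y = {}")
    case True
    then obtain K where K: "K \<in> P" "A \<subseteq> K" using Sat_in_component[OF at Node(5) A(1)] by metis
    then have "A \<notin> psi (f K)" using A(2) unfolding ps by blast
    then show ?thesis using y(3)[OF K(1) A(1) K(2)] sxK[OF K] by simp
  next
    case False
    have "A \<noteq> \<Union>H" using A(2) by (simp add: ps)
    moreover have "A \<subseteq> \<Union>H" using A(1) by (simp add: Sat_def)
    ultimately have AH: "A \<subset> \<Union>H" by (rule psubsetI[rotated])
    have pos': "x i \<ge> 0" if "i \<in> A" for i
      using pos[of i] psubsetD[OF AH that] by simp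
    have "A \<subseteq> Y \<union> \<Union>P" unfolding YP(2) using AH by (rule psubset_imp_subset)
    then have AYP: "A \<subseteq> (A \<inter> Y) \<union> \<Union>P" by blast
    have finA: "finite A" using psubset_imp_subset[OF AH] fin by (rule finite_subset)
    define a where "a = card (A \<inter> Y)"
    define k where "k = card (Y - A)"
    have l: "card Y = a + k" unfolding a_def k_def using finY
      by (metis Int_commute card_Int_Diff)
    have a1: "a \<ge> 1" unfolding a_def using False finY by (simp add: Suc_le_eq card_gt_0_iff)
    have "card A \<le> card ((A \<inter> Y) \<union> \<Union>P)" using finA finU AYP by (intro card_mono) auto
    also have "\<dots> \<le> a + r" unfolding a_def r_def by (rule card_Un_le)
    finally have c1: "card A \<le> a + r" .
    have c2: "card A < a + k + r" using psubset_card_mono[OF fin AH] cardH l by simp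
    \<comment> \<open>The chain first charges the children the full \<open>3 ^ r\<close>, then their
      actual mass, which is no larger, and finally adds back the non-negative coordinates of
      \<open>A\<close> outside \<open>Y\<close>.\<close>
    have "3 ^ card A < real a * (3 ^ (a + k + r) - 3 ^ r) / real (a + k)"
      using weight_inequality[OF a1 c1 c2] a1 by (simp add: pos_less_divide_eq mult.commute)
    also have "\<dots> \<le> real a * (3 ^ (a + k + r) - (\<Sum>K\<in>P. 3 ^ card K)) / real (a + k)"
      using S by (intro divide_right_mono mult_left_mono) auto
    also have "\<dots> = real a * w" unfolding w_def cardH l by simp
    also have "\<dots> = sum x (A \<inter> Y)" using sxY[of "A \<inter> Y"] by (simp add: a_def)
    also have "\<dots> \<le> sum x A" using finA pos' by (intro sum_mono2) auto
    finally show ?thesis .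
  qed
  show ?case
  proof (intro exI[of _ x] conjI ballI)
    show "sum x A > 3 ^ card A" if "A \<in> Sat H - psi (Node Y Ts)" for A using that by (intro gt) simp_all
  qed (use pos eq in blast)+
qed

text \<open>If \<open>A\<close> and the union so far are incomparable, both are smaller than the new
  union, so each power is at most a third of the new one and the inequality is strict. Otherwise the
  new union is one of the two, and membership in the family persists.\<close>

lemma sum_Union_le_power3:
  fixes x :: "'b \<Rightarrow> real"
  assumes "finite F" "F \<noteq> {}" "\<And>A. A \<in> F \<Longrightarrow> finite A" "\<And>i. i \<in> \<Union>F \<Longrightarrow> x i \<ge> 0"
    and "\<And>A. A \<in> F \<Longrightarrow> sum x A = 3 ^ card A"
  shows "sum x (\<Union>F) \<le> 3 ^ card (\<Union>F) \<and> (sum x (\<Union>F) = 3 ^ card (\<Union>F) \<longrightarrow> \<Union>F \<in> F)"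
  using assms
proof (induction F rule: finite_ne_induct)
  case (insert A F)
  let ?U = "\<Union>F"
  have "sum x ?U \<le> 3 ^ card ?U \<and> (sum x ?U = 3 ^ card ?U \<longrightarrow> ?U \<in> F)"
    using insert.prems by (intro insert.IH) simp_all
  then have IH: "sum x ?U \<le> 3 ^ card ?U" "sum x ?U = 3 ^ card ?U \<longrightarrow> ?U \<in> F" by simp_all
  have A: "finite A" "sum x A = 3 ^ card A" using insert.prems by simp_all
  have finU: "finite ?U" using insert.hyps(1) insert.prems(1) by simp
  consider "A \<subseteq> ?U" | "?U \<subseteq> A" | "A \<subset> A \<union> ?U" "?U \<subset> A \<union> ?U" by blast
  then show ?case
  proof cases
    case 1
    then have "\<Union>(insert A F) = ?U" by auto
    then show ?thesis using IH by simp
  next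
    case 2
    then have "\<Union>(insert A F) = A" by auto
    then show ?thesis using A by simp
  next
    case 3
    have fin: "finite (A \<union> ?U)" using A finU by simp
    have "card A < card (A \<union> ?U)" "card ?U < card (A \<union> ?U)"
      using psubset_card_mono[OF fin 3(1)] psubset_card_mono[OF fin 3(2)] .
    then have "3 * (3::real) ^ card A \<le> 3 ^ card (A \<union> ?U)" "3 * (3::real) ^ card ?U \<le> 3 ^ card (A \<union> ?U)"
      using power_increasing[of "Suc (card A)" "card (A \<union> ?U)" "3::real"]
        power_increasing[of "Suc (card ?U)" "card (A \<union> ?U)" "3::real"] by simp_all
    moreover have "sum x (A \<union> ?U) + sum x (A \<inter> ?U) = sum x A + sum x ?U"
      using A(1) finU by (rule sum.union_inter)
    moreover have "sum x (A \<inter> ?U) \<ge> 0" by (intro sum_nonneg insert.prems(2)) simp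
    moreover have "(0::real) < 3 ^ card (A \<union> ?U)" by simp
    ultimately have "sum x (A \<union> ?U) < 3 ^ card (A \<union> ?U)" using A(2) IH(1) by linarith
    then show ?thesis by simp
  qed
qed simp

text \<open>On a connected union of tight sets, feasibility and \<open>sum_Union_le_power3\<close>
  give opposite inequalities, and the equality case puts the union into the family. Coordinates are
  non-negative by the inequalities of the singletons.\<close>

lemma tight_nested:
  fixes x :: "'a \<Rightarrow> real"
  assumes ah: "atomic_hyp H" and con: "hyp_connected H" "\<Union>H \<noteq> {}"
    and ge: "\<And>A. A \<in> Sat H \<Longrightarrow> sum x A \<ge> 3 ^ card A" and top: "sum x (\<Union>H) = 3 ^ card (\<Union>H)"
  shows "nested H {A \<in> Sat H. sum x A = 3 ^ card A}" (is "nested H ?N")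
proof -
  have fin: "finite (\<Union>H)" and at: "atomic H" using ah by (auto simp: hypergraph_on_def)
  have sing: "{i} \<in> Sat H" if "i \<in> \<Union>H" for i
  proof -
    have U: "\<Union>(restr H {i}) = {i}" using that by (intro Union_restr[OF at]) auto
    have "hyp_connected (restr H {i})"
      unfolding hyp_connected_def U by (auto simp: Un_singleton_iff)
    then show ?thesis using that by (auto simp: Sat_def)
  qed
  have pos: "x i \<ge> 0" if "i \<in> \<Union>H" for i using ge[OF sing[OF that]] by simp
  have "\<Union>F \<in> F" if F: "F \<subseteq> ?N" "F \<noteq> {}" "\<Union>F \<in> Sat H" for F
  proof -
    have sub: "A \<subseteq> \<Union>H" if "A \<in> F" for A using that F(1) by (auto simp: Sat_def)
    have "finite F" using F(1) finite_subset[OF _ finite_Sat[OF ah], of F] by auto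
    moreover have "x i \<ge> 0" if "i \<in> \<Union>F" for i using that sub by (intro pos) blast
    moreover have "finite A" if "A \<in> F" for A using sub[OF that] fin by (rule finite_subset)
    ultimately have "sum x (\<Union>F) \<le> 3 ^ card (\<Union>F)" "sum x (\<Union>F) = 3 ^ card (\<Union>F) \<longrightarrow> \<Union>F \<in> F"
      using sum_Union_le_power3[of F x] F(1,2) by auto
    then show ?thesis using ge[OF F(3)] by simp
  qed
  moreover have "\<Union>H \<in> ?N" using Union_in_Sat[OF con] top by simp
  moreover have "?N \<subseteq> Sat H" by blast
  ultimately show ?thesis unfolding nested_def by simp
qed

section \<open>Faces of the realisation\<close>

definition tight :: "'n set set \<Rightarrow> real ^ 'n::finite \<Rightarrow> 'n set set" where
  "tight H x = {A \<in> Sat H. (\<Sum>i\<in>A. x $ i) = 3 ^ card A}"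

text \<open>Treats the equation of the carrier as one more inequality that is always tight, so later
  arguments need no exception for it.\<close>

lemma mem_realisation_iff:
  assumes "\<Union>H \<in> Sat H"
  shows "x \<in> realisation H \<longleftrightarrow>
    (\<forall>A\<in>Sat H. (\<Sum>i\<in>A. x $ i) \<ge> 3 ^ card A) \<and> \<Union>H \<in> tight H x"
proof -
  have "x \<in> realisation H \<longleftrightarrow>
    (\<forall>A\<in>Sat H - {\<Union>H}. (\<Sum>i\<in>A. x $ i) \<ge> 3 ^ card A) \<and> (\<Sum>i\<in>\<Union>H. x $ i) = 3 ^ card (\<Union>H)"
    by (simp add: realisation_def halfspace_def hyperplane_def)
  then show ?thesis using assms unfolding tight_def by (metis (mono_tags, lifting) DiffE DiffI
    dual_order.refl mem_Collect_eq singletonD)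
qed

lemma mem_Pi_face_iff: "M \<subseteq> Sat H \<Longrightarrow> x \<in> Pi_face H M \<longleftrightarrow> M \<subseteq> tight H x \<and> x \<in> realisation H"
  unfolding Pi_face_def hyperplane_def tight_def by auto

lemma sum_convex_comb:
  "(\<Sum>i\<in>A. ((1 - u) *\<^sub>R a + u *\<^sub>R b) $ i) = (1 - u) * (\<Sum>i\<in>A. a $ i) + u * (\<Sum>i\<in>A. b $ i)"
  for a b :: "real ^ 'n::finite"
  by (simp add: sum.distrib sum_distrib_left)

text \<open>At an interior point of a segment the slack is a positive combination of the slacks at
  the ends; these are non-negative, so if it vanishes, both do.\<close>

lemma Pi_face_face_of:
  fixes H :: "'n::finite set set"
  assumes conv: "convex (realisation H)" and top: "\<Union>H \<in> Sat H" and M: "M \<subseteq> Sat H"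
  shows "Pi_face H M face_of realisation H"
proof -
  have "convex (hyperplane A)" for A :: "'n set"
    unfolding convex_alt hyperplane_def mem_Collect_eq sum_convex_comb by (simp add: algebra_simps)
  then have cv: "convex (Pi_face H M)"
    unfolding Pi_face_def using conv by (intro convex_Int convex_INT) auto
  have ext: "a \<in> Pi_face H M \<and> b \<in> Pi_face H M"
    if ab: "a \<in> realisation H" "b \<in> realisation H" and x: "x \<in> Pi_face H M" "x \<in> open_segment a b" for a b x
  proof -
    obtain u where u: "0 < u" "u < 1" "x = (1 - u) *\<^sub>R a + u *\<^sub>R b"
      using x(2) by (auto simp: in_segment)
    have "(\<Sum>i\<in>A. a $ i) = 3 ^ card A \<and> (\<Sum>i\<in>A. b $ i) = 3 ^ card A" if A: "A \<in> M" for A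
    proof -
      have "(1 - u) * (\<Sum>i\<in>A. a $ i) + u * (\<Sum>i\<in>A. b $ i) = 3 ^ card A"
        using x(1) A unfolding mem_Pi_face_iff[OF M] u(3) tight_def sum_convex_comb by blast
      then have "(1 - u) * ((\<Sum>i\<in>A. a $ i) - 3 ^ card A) + u * ((\<Sum>i\<in>A. b $ i) - 3 ^ card A) = 0"
        by (simp add: algebra_simps)
      moreover have "(\<Sum>i\<in>A. a $ i) \<ge> 3 ^ card A" "(\<Sum>i\<in>A. b $ i) \<ge> 3 ^ card A"
        using ab A M unfolding mem_realisation_iff[OF top] by auto
      ultimately show ?thesis
        using u(1,2) by (subst (asm) add_nonneg_eq_0_iff) auto
    qed
    then show ?thesis using ab M unfolding mem_Pi_face_iff[OF M] tight_def by blast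
  qed
  show ?thesis
    unfolding face_of_def
  proof (intro conjI ballI impI)
    show "Pi_face H M \<subseteq> realisation H" by (simp add: Pi_face_def)
  qed (use cv ext in blast)+
qed

text \<open>
  If every inequality tight at \<open>x\<close> is tight at \<open>y\<close>, then the segment from \<open>y\<close> to \<open>x\<close> can be
  prolonged beyond \<open>x\<close> inside the realisation, since the inequalities not tight at \<open>x\<close> hold near \<open>x\<close>.
\<close>

lemma Pi_face_tight_subset:
  fixes H :: "'n::finite set set"
  assumes top: "\<Union>H \<in> Sat H" and F: "F face_of realisation H" and x: "x \<in> F"
  shows "Pi_face H (tight H x) \<subseteq> F"
proof
  fix y assume "y \<in> Pi_face H (tight H x)"
  then have y: "y \<in> realisation H" "tight H x \<subseteq> tight H y"
    using mem_Pi_face_iff[of "tight H x" H y] by (auto simp: tight_def)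
  have xR: "x \<in> realisation H" using F x face_of_imp_subset by blast
  \<comment> \<open>This is \<open>x + e (x - y)\<close>, written with coefficient
    \<open>- e\<close> so that \<open>sum_convex_comb\<close> applies.\<close>
  let ?z = "\<lambda>e. (1 - (- e)) *\<^sub>R x + (- e) *\<^sub>R y"
  have "\<forall>\<^sub>F e in at_right 0. (\<Sum>i\<in>A. ?z e $ i) \<ge> 3 ^ card A" if "A \<in> Sat H" for A
  proof (cases "A \<in> tight H x")
    case True
    then have "A \<in> tight H y" using y(2) by blast
    with True have "(\<Sum>i\<in>A. ?z e $ i) = 3 ^ card A" for e
      unfolding sum_convex_comb by (simp add: tight_def algebra_simps)
    then show ?thesis by simp
  next
    case False
    have "3 ^ card A \<le> (\<Sum>i\<in>A. x $ i)" using that xR unfolding mem_realisation_iff[OF top] by blast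
    then have "3 ^ card A < (\<Sum>i\<in>A. x $ i)" using False that by (simp add: tight_def)
    moreover have "((\<lambda>e. \<Sum>i\<in>A. ?z e $ i) \<longlongrightarrow> (1 - (- 0)) * (\<Sum>i\<in>A. x $ i) + (- 0) * (\<Sum>i\<in>A. y $ i)) (at_right 0)"
      unfolding sum_convex_comb by (intro tendsto_intros)
    ultimately have "\<forall>\<^sub>F e in at_right 0. (\<Sum>i\<in>A. ?z e $ i) > 3 ^ card A"
      by (intro order_tendstoD(1)) auto
    then show ?thesis by eventually_elim simp
  qed
  \<comment> \<open>There are finitely many inequalities, so one small \<open>e\<close> serves them
    all.\<close>
  then have "\<forall>\<^sub>F e in at_right 0. \<forall>A\<in>Sat H. (\<Sum>i\<in>A. ?z e $ i) \<ge> 3 ^ card A"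
    by (intro eventually_ball_finite) auto
  moreover have "\<forall>\<^sub>F e::real in at_right 0. e > 0" by (simp add: eventually_at_right_less)
  ultimately have "\<forall>\<^sub>F e in at_right 0. e > 0 \<and> (\<forall>A\<in>Sat H. (\<Sum>i\<in>A. ?z e $ i) \<ge> 3 ^ card A)"
    by eventually_elim simp
  then obtain e :: real where e: "e > 0" "\<forall>A\<in>Sat H. (\<Sum>i\<in>A. ?z e $ i) \<ge> 3 ^ card A"
    using eventually_happens' trivial_limit_at_right_real by blast
  have "\<Union>H \<in> tight H x" "\<Union>H \<in> tight H y" using xR y(1) unfolding mem_realisation_iff[OF top] by auto
  then have "\<Union>H \<in> tight H (?z e)"
    unfolding tight_def mem_Collect_eq sum_convex_comb by (simp add: algebra_simps)
  with e(2) have zR: "?z e \<in> realisation H" unfolding mem_realisation_iff[OF top] by blast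
  show "y \<in> F"
  proof (cases "x = y")
    case False
    \<comment> \<open>The solution of \<open>(1 - s) * (1 + e) = 1\<close>, which exhibits
      \<open>x\<close> as a point strictly between \<open>?z e\<close> and \<open>y\<close>.\<close>
    define s where "s = e / (1 + e)"
    have "(1 - s) *\<^sub>R ?z e + s *\<^sub>R y = ((1 - s) * (1 + e)) *\<^sub>R x + (s - (1 - s) * e) *\<^sub>R y"
      by (simp add: algebra_simps)
    moreover have "(1 - s) * (1 + e) = 1" "s - (1 - s) * e = 0"
      using e(1) by (simp_all add: s_def field_simps)
    ultimately have "x = (1 - s) *\<^sub>R ?z e + s *\<^sub>R y" by simp
    moreover have "?z e \<noteq> y"
    proof
      assume "?z e = y"
      then have "(1 + e) *\<^sub>R (x - y) = 0" by (simp add: algebra_simps)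
      then show False using False e(1) by simp
    qed
    moreover have "0 < s" "s < 1" using e(1) by (auto simp: s_def)
    ultimately have "x \<in> open_segment (?z e) y" unfolding in_segment by blast
    then show ?thesis using face_ofD[OF F _ zR y(1) x] by blast
  qed (use x in simp)
qed

theorem theorem1:
  fixes H :: "'n::finite set set"
  assumes "hypergraph_on UNIV H"
    and "atomic H"
    and "hyp_connected H"
  shows "bij_betw (\<lambda>T. Pi_face H (psi T)) {T. is_construct H T}
           {F. F face_of realisation H \<and> F \<noteq> {}} \<and>
         (\<forall>S T. is_construct H S \<longrightarrow> is_construct H T \<longrightarrow>
           (construct_le H S T \<longleftrightarrow> Pi_face H (psi S) \<subseteq> Pi_face H (psi T)))"
proof -
  have U: "\<Union>H = UNIV" using assms(1) by (simp add: hypergraph_on_def)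
  then have ah: "atomic_hyp H" using assms(1,2) by simp
  have top: "\<Union>H \<in> Sat H" using Union_in_Sat[OF assms(3)] U by simp
  have conv: "convex (realisation H)"
    using polytope_realisation[OF assms(1,2)] by (rule polytope_imp_convex)
  have pt: "\<exists>x\<in>realisation H. tight H x = psi T" if T: "is_construct H T" for T
  proof -
    obtain x :: "'n \<Rightarrow> real" where x: "\<forall>A\<in>psi T. sum x A = 3 ^ card A"
      "\<forall>A\<in>Sat H - psi T. sum x A > 3 ^ card A"
      using construct_point[OF T ah] by blast
    let ?x = "\<chi> i. x i"
    have tt: "tight H ?x = psi T"
      using x psi_Sat[OF T ah] by (force simp: tight_def)
    moreover have "?x \<in> realisation H"
      unfolding mem_realisation_iff[OF top] tt
    proof (intro conjI ballI)
      show "\<Union>H \<in> psi T" using up_in_psi[of T] up_construct[OF T ah] by simp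
      fix A assume "A \<in> Sat H"
      then show "3 ^ card A \<le> (\<Sum>i\<in>A. ?x $ i)" using x by (cases "A \<in> psi T") (auto intro: less_imp_le)
    qed
    ultimately show ?thesis by blast
  qed
  \<comment> \<open>The point tight exactly on \<open>psi S\<close> lies in the first face; if it
    also lies in the second, then \<open>psi T\<close> is among its tight sets.\<close>
  have sub: "Pi_face H (psi S) \<subseteq> Pi_face H (psi T) \<longleftrightarrow> psi T \<subseteq> psi S"
    if S: "is_construct H S" and T: "is_construct H T" for S T
  proof
    obtain x where x: "x \<in> realisation H" "tight H x = psi S" using pt[OF S] by blast
    assume "Pi_face H (psi S) \<subseteq> Pi_face H (psi T)"
    moreover have "x \<in> Pi_face H (psi S)" using x mem_Pi_face_iff[OF psi_Sat[OF S ah]] by simp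
    ultimately have "x \<in> Pi_face H (psi T)" by blast
    then show "psi T \<subseteq> psi S" using x(2) mem_Pi_face_iff[OF psi_Sat[OF T ah], of x] by simp
  next
    assume "psi T \<subseteq> psi S"
    then show "Pi_face H (psi S) \<subseteq> Pi_face H (psi T)" unfolding Pi_face_def by blast
  qed
  have "inj_on (\<lambda>T. Pi_face H (psi T)) {T. is_construct H T}"
  proof (rule inj_onI)
    fix S T assume ST: "S \<in> {T. is_construct H T}" "T \<in> {T. is_construct H T}"
      and eq: "Pi_face H (psi S) = Pi_face H (psi T)"
    then have "psi S = psi T" using sub[of S T] sub[of T S] by simp
    then show "S = T" using psi_inj[OF _ ah] ST by blast
  qed
  moreover have "Pi_face H (psi T) face_of realisation H \<and> Pi_face H (psi T) \<noteq> {}"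
    if T: "is_construct H T" for T
  proof
    show "Pi_face H (psi T) face_of realisation H"
      using Pi_face_face_of[OF conv top psi_Sat[OF T ah]] .
    show "Pi_face H (psi T) \<noteq> {}" using pt[OF T] mem_Pi_face_iff[OF psi_Sat[OF T ah]] by blast
  qed
  moreover have "\<exists>T. is_construct H T \<and> F = Pi_face H (psi T)"
    if F: "F face_of realisation H" "F \<noteq> {}" for F
  proof -
    \<comment> \<open>For \<open>x\<close> in the relative interior, \<open>F\<close> equals the
      face cut out by \<open>tight H x\<close>: a face meeting the relative interior of
      \<open>F\<close> contains \<open>F\<close>, and \<open>Pi_face_tight_subset\<close> gives the
      reverse.\<close>
    have "rel_interior F \<noteq> {}" using F face_of_imp_convex rel_interior_eq_empty by blast
    then obtain x where x: "x \<in> rel_interior F" by blast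
    then have xF: "x \<in> F" using rel_interior_subset by blast
    then have xR: "x \<in> realisation H" using F(1) face_of_imp_subset by blast
    then have "nested H (tight H x)"
      unfolding tight_def using tight_nested[OF ah assms(3), of "\<lambda>i. x $ i"] U
      unfolding mem_realisation_iff[OF top] by (simp add: tight_def)
    then obtain T where T: "is_construct H T" "psi T = tight H x" using nested_construct[OF ah] by blast
    have tS: "tight H x \<subseteq> Sat H" by (auto simp: tight_def)
    have "F \<subseteq> Pi_face H (tight H x)"
    proof (rule subset_of_face_of[OF Pi_face_face_of[OF conv top tS]])
      show "F \<subseteq> realisation H" using F(1) by (rule face_of_imp_subset)
      show "Pi_face H (tight H x) \<inter> rel_interior F \<noteq> {}"
        using x xR mem_Pi_face_iff[OF tS] by blast
    qed
    then show ?thesis using Pi_face_tight_subset[OF top F(1) xF] T by auto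
  qed
  ultimately have "bij_betw (\<lambda>T. Pi_face H (psi T)) {T. is_construct H T}
           {F. F face_of realisation H \<and> F \<noteq> {}}"
    unfolding bij_betw_def by (intro conjI) (assumption, auto)
  then show ?thesis using construct_le_iff[OF ah] sub by simp
qed

end
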